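(* Let $X$ be a normed space, let $F\subseteq X$ be a nonempty closed convex set, and let $Q\subseteq X$ be a nonempty convex set. For $\bar x\in Q$ one has $$\partial\mathcal{T}^F_Q(\bar x)=N(\bar x;Q)\cap C^*,\qquad\text{where } C^*=\{x^*\in X^*: \sigma_F(-x^* )\le 1\}.$$ Suppose further that $0\in F$. Then $$\partial\mathcal{T}^F_Q(\bar x)=N(\bar x;Q-F_\infty)\cap C^*=N(\bar x;Q)\cap C^*.$$
   Context: Normed spaces are real; $X^*$ is the dual of $X$ and $\langle x^*,x\rangle=x^*(x)$. For $t\ge 0$, $tF=\{tf: f\in F\}$ (so $0F=\{0\}$), and $\inf\emptyset=\infty$. The minimal time function is $\mathcal{T}^F_Q(x)=\inf\{t\ge 0: (x+tF)\cap Q\ne\emptyset\}\in[0,\infty]$. The asymptotic cone of $F$ is $F_\infty=\{d\in X: x+td\in F \text{ for all } t>0\}$, where $x\in F$ is any point (the set does not depend on the choice of $x\in F$). $\sigma_F(x^* )=\sup\{\langle x^*,f\rangle: f\in F\}$. For a convex $\varphi:X\to(-\infty,\infty]$ and $\bar x$ with $\varphi(\bar x)<\infty$, $\partial\varphi(\bar x)=\{x^*\in X^*: \langle x^*,x-\bar x\rangle\le\varphi(x)-\varphi(\bar x)\text{ for all }x\in X\}$. For a convex set $A$ and $\bar x\in A$, $N(\bar x;A)=\{x^*\in X^*: \langle x^*,x-\bar x\rangle\le 0\text{ for all }x\in A\}$. *)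

theory Defs
  imports "HOL-Analysis.Analysis"
begin

text \<open>
  The dual of a real normed space \<open>'a\<close> is the type \<open>'a \<Rightarrow>\<^sub>L real\<close> of bounded linear functionals.
\<close>

(* Inf {} = \<infinity> in ereal, so points that cannot reach Q get the value \<infinity>. *)
definition min_time :: "'a::real_normed_vector set \<Rightarrow> 'a set \<Rightarrow> 'a \<Rightarrow> ereal" where
  "min_time F Q x = Inf {ereal t | t. 0 \<le> t \<and> ((+) x ` ((*\<^sub>R) t ` F)) \<inter> Q \<noteq> {}}"

(* The base point is irrelevant for closed convex F, see asymptotic_cone_iff below. *)
definition asymptotic_cone :: "'a::real_normed_vector set \<Rightarrow> 'a set" where
  "asymptotic_cone F = {d. \<exists>x\<in>F. \<forall>t>0. x + t *\<^sub>R d \<in> F}"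

definition support_fun :: "'a::real_normed_vector set \<Rightarrow> ('a \<Rightarrow>\<^sub>L real) \<Rightarrow> ereal" where
  "support_fun F x' = (SUP f\<in>F. ereal (blinfun_apply x' f))"

(* Meant for convex \<phi> with values in (-\<infinity>, \<infinity>] and \<phi> u < \<infinity>; the difference is then never
   of the form \<infinity> - \<infinity>. *)
definition subdifferential ::
    "('a::real_normed_vector \<Rightarrow> ereal) \<Rightarrow> 'a \<Rightarrow> ('a \<Rightarrow>\<^sub>L real) set" where
  "subdifferential \<phi> u = {x'. \<forall>x. ereal (blinfun_apply x' (x - u)) \<le> \<phi> x - \<phi> u}"

(* Meant for convex A and u \<in> A. *)
definition normal_cone :: "'a::real_normed_vector \<Rightarrow> 'a set \<Rightarrow> ('a \<Rightarrow>\<^sub>L real) set" where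
  "normal_cone u A = {x'. \<forall>x\<in>A. blinfun_apply x' (x - u) \<le> 0}"

definition C_star :: "'a::real_normed_vector set \<Rightarrow> ('a \<Rightarrow>\<^sub>L real) set" where
  "C_star F = {x'. support_fun F (- x') \<le> 1}"

definition set_diff :: "'a::real_normed_vector set \<Rightarrow> 'a set \<Rightarrow> 'a set" where
  "set_diff A B = {a - b | a b. a \<in> A \<and> b \<in> B}"

lemma asymptotic_cone_iff:
  fixes F :: "'a::real_normed_vector set"
  assumes "closed F" "convex F" "y \<in> F"
  shows "d \<in> asymptotic_cone F \<longleftrightarrow> (\<forall>t>0. y + t *\<^sub>R d \<in> F)"
proof
  assume "d \<in> asymptotic_cone F"
  then obtain x where x: "x \<in> F" "\<And>t. t > 0 \<Longrightarrow> x + t *\<^sub>R d \<in> F"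
    unfolding asymptotic_cone_def by blast
  show "\<forall>t>0. y + t *\<^sub>R d \<in> F"
  proof (intro allI impI)
    fix t :: real assume t: "t > 0"
    define e where "e n = inverse (real (Suc n))" for n
    have e: "0 < e n" "e n \<le> 1" for n
      by (auto simp: e_def divide_simps)
    define z where "z n = (1 - e n) *\<^sub>R y + e n *\<^sub>R (x + (t / e n) *\<^sub>R d)" for n
    have "z n \<in> F" for n
      unfolding z_def
    proof (rule convexD[OF assms(2,3)])
      show "x + (t / e n) *\<^sub>R d \<in> F"
        using x(2) t e(1)[of n] by simp
    qed (use e[of n] in auto)
    moreover have "z = (\<lambda>n. (1 - e n) *\<^sub>R y + e n *\<^sub>R x + t *\<^sub>R d)"
      using e(1) by (auto simp: z_def fun_eq_iff scaleR_add_right order_less_imp_not_eq2)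
    moreover have "e \<longlonglongrightarrow> 0"
      unfolding e_def by (rule LIMSEQ_inverse_real_of_nat)
    hence "(\<lambda>n. (1 - e n) *\<^sub>R y + e n *\<^sub>R x + t *\<^sub>R d) \<longlonglongrightarrow> (1 - 0) *\<^sub>R y + 0 *\<^sub>R x + t *\<^sub>R d"
      by (intro tendsto_intros)
    ultimately show "y + t *\<^sub>R d \<in> F"
      using closed_sequentially[OF assms(1)] by (metis diff_zero scaleR_one scaleR_zero_left add.right_neutral)
  qed
qed (use assms(3) in \<open>auto simp: asymptotic_cone_def\<close>)

end

theory Submission
  imports Defs
begin

text \<open>The minimal time vanishes on \<open>Q\<close>, so a subgradient at \<open>u\<close> in
  \<open>Q\<close> is nonpositive on \<open>Q - u\<close>; and each \<open>u - f\<close> with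
  \<open>f\<close> in \<open>F\<close> reaches \<open>u\<close> within time 1, which forces
  \<open>- x' f \<le> 1\<close>. Conversely, if \<open>x + t f = q\<close> lies in \<open>Q\<close>,
  then \<open>x' (x - u) = x' (q - u) - t x' f \<le> t\<close>, and the infimum over such
  \<open>t\<close> is the subgradient inequality. This is \<open>subdifferential_min_time\<close>.
  If \<open>0\<close> is in \<open>F\<close>, a functional in \<open>C_star F\<close> is bounded
  below by -1 on \<open>F\<close>, hence nonnegative along every ray from \<open>0\<close> inside
  \<open>F\<close>. Subtracting asymptotic directions from \<open>Q\<close> therefore preserves
  normality, which gives \<open>normal_cone_diff_asymptotic_cone\<close>.\<close>

lemma mem_C_star_iff: "x' \<in> C_star F \<longleftrightarrow> (\<forall>f\<in>F. - blinfun_apply x' f \<le> 1)"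
  by (simp add: C_star_def support_fun_def SUP_le_iff blinfun.minus_left)

lemma min_time_nonneg: "0 \<le> min_time F Q x"
  unfolding min_time_def by (rule Inf_greatest) auto

lemma min_time_le:
  assumes "0 \<le> t" "f \<in> F" "x + t *\<^sub>R f \<in> Q"
  shows "min_time F Q x \<le> ereal t"
  unfolding min_time_def using assms by (intro Inf_lower) blast

lemma min_time_eq_0:
  assumes "F \<noteq> {}" "x \<in> Q"
  shows "min_time F Q x = 0"
proof -
  obtain f where "f \<in> F"
    using assms(1) by blast
  then have "min_time F Q x \<le> 0"
    using min_time_le[of 0 f F x Q] assms(2) by (simp add: zero_ereal_def)
  then show ?thesis
    using min_time_nonneg by (rule antisym)
qed

lemma subdifferential_min_time:
  assumes "F \<noteq> {}" "u \<in> Q"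
  shows "subdifferential (min_time F Q) u = normal_cone u Q \<inter> C_star F"
proof (intro equalityI subsetI)
  fix x' assume "x' \<in> subdifferential (min_time F Q) u"
  then have sub: "ereal (blinfun_apply x' (x - u)) \<le> min_time F Q x" for x
    using min_time_eq_0[OF assms] by (simp add: subdifferential_def)
  have "blinfun_apply x' (x - u) \<le> 0" if "x \<in> Q" for x
    using sub[of x] min_time_eq_0[OF assms(1) that] by simp
  moreover have "- blinfun_apply x' f \<le> 1" if "f \<in> F" for f
  proof -
    \<comment> \<open>Moving from \<open>u - f\<close> along \<open>f\<close> for time 1 arrives at
      \<open>u\<close>, a point of \<open>Q\<close>.\<close>
    have "min_time F Q (u - f) \<le> ereal 1"
      using that assms(2) by (intro min_time_le[of _ f]) auto
    with sub[of "u - f"] have "ereal (blinfun_apply x' (u - f - u)) \<le> ereal 1"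
      by (rule order_trans)
    then show ?thesis
      by (simp add: blinfun.minus_right)
  qed
  ultimately show "x' \<in> normal_cone u Q \<inter> C_star F"
    by (simp add: normal_cone_def mem_C_star_iff)
next
  fix x' assume "x' \<in> normal_cone u Q \<inter> C_star F"
  then have N: "\<And>q. q \<in> Q \<Longrightarrow> blinfun_apply x' (q - u) \<le> 0"
    and C: "\<And>f. f \<in> F \<Longrightarrow> - blinfun_apply x' f \<le> 1"
    by (auto simp: normal_cone_def mem_C_star_iff)
  \<comment> \<open>A bound below every admissible time also covers points that never reach
    \<open>Q\<close>: there the set of times is empty and its infimum is \<infinity>.\<close>
  have "ereal (blinfun_apply x' (x - u)) \<le> min_time F Q x" for x
    unfolding min_time_def
  proof (rule Inf_greatest)
    fix s assume "s \<in> {ereal t | t. 0 \<le> t \<and> (+) x ` (*\<^sub>R) t ` F \<inter> Q \<noteq> {}}"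
    then obtain t f where s: "s = ereal t" and t: "0 \<le> t" and f: "f \<in> F"
      and q: "x + t *\<^sub>R f \<in> Q"
      by blast
    have "blinfun_apply x' (x - u)
        = blinfun_apply x' (x + t *\<^sub>R f - u) + t * (- blinfun_apply x' f)"
      by (simp add: blinfun.add_right blinfun.diff_right blinfun.scaleR_right)
    also have "\<dots> \<le> 0 + t * 1"
      using N[OF q] C[OF f] t by (intro add_mono mult_left_mono) auto
    finally show "ereal (blinfun_apply x' (x - u)) \<le> s"
      by (simp add: s)
  qed
  then show "x' \<in> subdifferential (min_time F Q) u"
    using min_time_eq_0[OF assms] by (simp add: subdifferential_def)
qed

text \<open>A negative value at \<open>d\<close> would make \<open>- x'\<close> unbounded above on
  the ray through \<open>d\<close>, which lies in \<open>F\<close> because \<open>0\<close>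
  does.\<close>

lemma C_star_asymptotic_cone_nonneg:
  assumes "closed F" "convex F" "0 \<in> F" "x' \<in> C_star F" "d \<in> asymptotic_cone F"
  shows "0 \<le> blinfun_apply x' d"
proof (rule ccontr)
  assume "\<not> 0 \<le> blinfun_apply x' d"
  then have neg: "blinfun_apply x' d < 0"
    by simp
  \<comment> \<open>With this \<open>t\<close>, \<open>- x' (t d) = 2\<close>, which exceeds the
    bound 1.\<close>
  define t where "t = - 2 / blinfun_apply x' d"
  have "t > 0"
    using neg by (simp add: t_def divide_neg_neg)
  \<comment> \<open>The base point of the asymptotic cone is taken to be \<open>0\<close>.\<close>
  then have "t *\<^sub>R d \<in> F"
    using asymptotic_cone_iff[OF assms(1-3)] assms(5) by fastforce
  then have "- blinfun_apply x' (t *\<^sub>R d) \<le> 1"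
    using assms(4) mem_C_star_iff by blast
  then show False
    using neg by (simp add: t_def blinfun.scaleR_right blinfun.minus_right)
qed

text \<open>Enlarging a set shrinks its normal cone, and \<open>0\<close> is an asymptotic
  direction; for the reverse inclusion, \<open>x' (q - d - u) = x' (q - u) - x' d\<close> is a
  nonpositive number minus a nonnegative one.\<close>

lemma normal_cone_diff_asymptotic_cone:
  assumes "closed F" "convex F" "0 \<in> F"
  shows "normal_cone u (set_diff Q (asymptotic_cone F)) \<inter> C_star F
    = normal_cone u Q \<inter> C_star F"
proof (intro equalityI subsetI)
  fix x' assume x': "x' \<in> normal_cone u (set_diff Q (asymptotic_cone F)) \<inter> C_star F"
  have "0 \<in> asymptotic_cone F"
    using assms(3) by (auto simp: asymptotic_cone_def)
  then have "Q \<subseteq> set_diff Q (asymptotic_cone F)"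
    unfolding set_diff_def by force
  with x' show "x' \<in> normal_cone u Q \<inter> C_star F"
    by (auto simp: normal_cone_def)
next
  fix x' assume x': "x' \<in> normal_cone u Q \<inter> C_star F"
  have "blinfun_apply x' (q - d - u) \<le> 0" if "q \<in> Q" "d \<in> asymptotic_cone F" for q d
  proof -
    have "blinfun_apply x' (q - u) \<le> 0"
      using x' that(1) by (simp add: normal_cone_def)
    moreover have "0 \<le> blinfun_apply x' d"
      using C_star_asymptotic_cone_nonneg[OF assms _ that(2)] x' by simp
    ultimately show ?thesis
      by (simp add: blinfun.diff_right)
  qed
  with x' show "x' \<in> normal_cone u (set_diff Q (asymptotic_cone F)) \<inter> C_star F"
    by (auto simp: normal_cone_def set_diff_def)
qed

theorem theorem4p1:
  fixes F Q :: "'a::real_normed_vector set" and xbar :: 'a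
  assumes "F \<noteq> {}" and "closed F" and "convex F"
    and "Q \<noteq> {}" and "convex Q"
    and "xbar \<in> Q"
  shows "subdifferential (min_time F Q) xbar = normal_cone xbar Q \<inter> C_star F \<and>
    (0 \<in> F \<longrightarrow>
      subdifferential (min_time F Q) xbar
        = normal_cone xbar (set_diff Q (asymptotic_cone F)) \<inter> C_star F \<and>
      normal_cone xbar (set_diff Q (asymptotic_cone F)) \<inter> C_star F
        = normal_cone xbar Q \<inter> C_star F)"
  using subdifferential_min_time[OF assms(1,6)] normal_cone_diff_asymptotic_cone[OF assms(2,3)]
  by simp

end
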